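(* Let $n\in\mathbb N$. If $S\subset M_n$ is an operator system of dimension $d:=\dim_{\mathbb C}(S)>1$, then $\mathcal M(S)-\tfrac1n\mathbb 1\in\mathcal C_{d-1}''$, where the Euclidean space of traceless hermitian matrices of $S$ is identified with $\mathbb R^{d-1}$.
   Context: $M_n$ is the algebra of complex $n$-by-$n$ matrices with identity $\mathbb 1$ and Hilbert-Schmidt inner product $\langle a,b\rangle=\operatorname{tr}(a^*b)$. An operator system $S\subset M_n$ is a complex vector subspace which contains $\mathbb 1$ and is self-adjoint ($s\in S$ implies $s^*\in S$); $S_{\rm h}$ is the real space of hermitian matrices in $S$, a Euclidean space under the Hilbert-Schmidt inner product. The space of traceless matrices in $S_{\rm h}$ has real dimension $d-1$ and is identified isometrically with $\mathbb R^{d-1}$. For $a\in S$ define $f_a:S\to\mathbb C$, $f_a(s)=\langle a,s\rangle$. A state on $S$ is a complex linear functional $f:S\to\mathbb C$ which is positive ($f(s)\ge0$ for all positive-semidefinite $s\in S$) and normalized ($f(\mathbb 1)=1$). The state space of $S$ is $\mathcal M(S):=\{s\in S\mid f_s\text{ is a state on }S\}$. Let $m\in\mathbb N$. The relative interior of a convex set is its interior in its affine hull. For a convex set $C\subset\mathbb R^m$ the normal cone of $C$ at $x\in C$ is $N_C(x):=\{u\in\mathbb R^m\mid \forall y\in C:\ \langle u,y-x\rangle\le 0\}$. For a non-empty convex subset $F\subset C$, $N_C(F):=N_C(x)$ for any relative interior point $x$ of $F$ (well-defined), and $N_C(\emptyset):=\mathbb R^m$. $\mathcal N_C$ denotes the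 set of normal cones of $C$ at points of $C$ together with $N_C(\emptyset)=\mathbb R^m$. A proper normal cone of $C$ is an element of $\mathcal N_C$ other than $N_C(\emptyset)$ and $N_C(C)$. A face of a convex set is a convex subset containing every closed segment of the set whose relative interior it intersects. An exposed face is either the empty set or the set of minimizers of a linear form on the convex set; it is proper if it is neither empty nor the whole set. A proper convex subset of $\mathbb R^m$ is a convex subset of $\mathbb R^m$ with interior points which has a proper exposed face. $\mathcal C_m''$ is the class of proper convex subsets $C$ of $\mathbb R^m$ such that for every proper normal cone $N$ of $C$ every non-empty face of $N$ is in $\mathcal N_C$. *)

theory Defs
  imports "HOL-Analysis.Analysis"
begin

section \<open>Operator systems and their state spaces\<close>

text \<open>The library's scalar multiplications on \<^typ>\<open>complex^'n^'n\<close> are by reals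
  (\<^const>\<open>scaleR\<close>) or by vectors (\<^const>\<open>vector_scalar_mult\<close>), so the complex vector
  space structure of the matrix algebra is set up here.\<close>

definition cscale :: "complex \<Rightarrow> complex^'n^'n \<Rightarrow> complex^'n^'n"
  where "cscale c A = (\<chi> i j. c * A $ i $ j)"

global_interpretation cmat: vector_space "cscale :: complex \<Rightarrow> complex^'n^'n \<Rightarrow> complex^'n^'n"
  defines cmat_subspace = cmat.subspace
    and cmat_dim = cmat.dim
  by unfold_locales (simp_all add: cscale_def vec_eq_iff algebra_simps)

definition conj_transpose :: "complex^'n^'n \<Rightarrow> complex^'n^'n"
  where "conj_transpose A = (\<chi> i j. cnj (A $ j $ i))"

definition hs_inner :: "complex^'n^'n \<Rightarrow> complex^'n^'n \<Rightarrow> complex"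
  where "hs_inner a b = trace (conj_transpose a ** b)"

definition hermitian :: "complex^'n^'n \<Rightarrow> bool"
  where "hermitian A \<longleftrightarrow> conj_transpose A = A"

definition pos_semidef :: "complex^'n^'n \<Rightarrow> bool"
  where "pos_semidef A \<longleftrightarrow>
    hermitian A \<and> (\<forall>x. (\<Sum>i\<in>UNIV. cnj (x $ i) * (A *v x) $ i) \<in> \<real>\<^sub>\<ge>\<^sub>0)"

definition operator_system :: "(complex^'n^'n) set \<Rightarrow> bool"
  where "operator_system S \<longleftrightarrow>
    cmat.subspace S \<and> mat 1 \<in> S \<and> (\<forall>s\<in>S. conj_transpose s \<in> S)"

text \<open>A functional on \<open>S\<close> is a total HOL function of which only the values on \<open>S\<close> matter.\<close>

definition is_state :: "(complex^'n^'n) set \<Rightarrow> (complex^'n^'n \<Rightarrow> complex) \<Rightarrow> bool"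
  where "is_state S f \<longleftrightarrow>
    (\<forall>s\<in>S. \<forall>t\<in>S. f (s + t) = f s + f t) \<and>
    (\<forall>c. \<forall>s\<in>S. f (cscale c s) = c * f s) \<and>
    (\<forall>s\<in>S. pos_semidef s \<longrightarrow> f s \<in> \<real>\<^sub>\<ge>\<^sub>0) \<and>
    f (mat 1) = 1"

definition state_space :: "(complex^'n^'n) set \<Rightarrow> (complex^'n^'n) set"
  where "state_space S = {s \<in> S. is_state S (\<lambda>t. hs_inner s t)}"

definition traceless_hermitian :: "(complex^'n^'n) set \<Rightarrow> (complex^'n^'n) set"
  where "traceless_hermitian S = {s \<in> S. hermitian s \<and> trace s = 0}"

text \<open>An isometric identification of a Euclidean space \<open>real^'m\<close> with a real space \<open>V\<close> of
  hermitian matrices, where \<open>V\<close> carries the Hilbert-Schmidt inner product.\<close>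

definition hs_identification :: "(complex^'n^'n) set \<Rightarrow> (real^'m \<Rightarrow> complex^'n^'n) \<Rightarrow> bool"
  where "hs_identification V \<psi> \<longleftrightarrow>
    linear \<psi> \<and> range \<psi> = V \<and> (\<forall>x y. hs_inner (\<psi> x) (\<psi> y) = complex_of_real (x \<bullet> y))"

section \<open>Normal cones\<close>

definition normal_cone :: "'a::euclidean_space set \<Rightarrow> 'a \<Rightarrow> 'a set"
  where "normal_cone C x = {u. \<forall>y\<in>C. u \<bullet> (y - x) \<le> 0}"

text \<open>The normal cone of \<open>C\<close> at a non-empty convex subset \<open>F\<close> does not depend on the chosen
  point, see \<open>normal_cone_at_eq\<close> below.\<close>

definition normal_cone_at :: "'a::euclidean_space set \<Rightarrow> 'a set \<Rightarrow> 'a set"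
  where "normal_cone_at C F =
    (if F = {} then UNIV else normal_cone C (SOME x. x \<in> rel_interior F))"

lemma normal_cone_rel_interior_subset:
  assumes "convex F" "F \<subseteq> C" "x \<in> rel_interior F" "z \<in> F"
  shows "normal_cone C x \<subseteq> normal_cone C z"
proof
  fix u assume u: "u \<in> normal_cone C x"
  obtain e where e: "e > 1" "(1 - e) *\<^sub>R z + e *\<^sub>R x \<in> F"
    using convex_rel_interior_if2[OF assms(1,3)] assms(4) hull_inc[of z F affine] by force
  have "u \<bullet> ((1 - e) *\<^sub>R z + e *\<^sub>R x - x) \<le> 0"
    using u e(2) assms(2) by (auto simp: normal_cone_def)
  also have "(1 - e) *\<^sub>R z + e *\<^sub>R x - x = (e - 1) *\<^sub>R (x - z)"
    by (simp add: algebra_simps)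
  finally have xz: "u \<bullet> (x - z) \<le> 0"
    using e(1) by (simp add: mult_le_0_iff)
  have "u \<bullet> (y - z) \<le> 0" if "y \<in> C" for y
  proof -
    have "u \<bullet> (y - x) \<le> 0" using u that by (auto simp: normal_cone_def)
    with xz show ?thesis by (simp add: inner_diff_right)
  qed
  then show "u \<in> normal_cone C z" by (simp add: normal_cone_def)
qed

lemma normal_cone_at_eq:
  assumes "convex F" "F \<subseteq> C" "x \<in> rel_interior F"
  shows "normal_cone_at C F = normal_cone C x"
proof -
  let ?z = "SOME z. z \<in> rel_interior F"
  have z: "?z \<in> rel_interior F" using assms(3) by (rule someI)
  have "F \<noteq> {}" using assms(3) rel_interior_subset by blast
  moreover have "normal_cone C ?z = normal_cone C x"
    using normal_cone_rel_interior_subset[OF assms(1,2)] z assms(3) rel_interior_subset by blast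
  ultimately show ?thesis by (simp add: normal_cone_at_def)
qed

definition normal_cones :: "'a::euclidean_space set \<Rightarrow> 'a set set"
  where "normal_cones C = insert (normal_cone_at C {}) (normal_cone C ` C)"

definition proper_normal_cone :: "'a::euclidean_space set \<Rightarrow> 'a set \<Rightarrow> bool"
  where "proper_normal_cone C N \<longleftrightarrow>
    N \<in> normal_cones C \<and> N \<noteq> normal_cone_at C {} \<and> N \<noteq> normal_cone_at C C"

definition proper_convex :: "'a::euclidean_space set \<Rightarrow> bool"
  where "proper_convex C \<longleftrightarrow>
    convex C \<and> interior C \<noteq> {} \<and> (\<exists>F. F exposed_face_of C \<and> F \<noteq> {} \<and> F \<noteq> C)"

text \<open>The class \<open>\<C>\<^sub>m''\<close>, where \<open>m\<close> is the dimension of the ambient space.\<close>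

definition class_C'' :: "'a::euclidean_space set set"
  where "class_C'' = {C. proper_convex C \<and>
    (\<forall>N. proper_normal_cone C N \<longrightarrow>
      (\<forall>F. F face_of N \<and> F \<noteq> {} \<longrightarrow> F \<in> normal_cones C))}"

end

theory Submission
  imports Defs
begin

text \<open>
  The state space is a polar body. Identify the traceless hermitian matrices of \<open>S\<close> with a Euclidean
  space by \<open>\<psi>\<close>, and let \<open>D\<close> be the set of all \<open>d\<close> for which \<open>1 - \<psi> d\<close> is positive semidefinite.
  Up to scaling, the matrices \<open>1 - \<psi> d\<close> are all the positive semidefinite elements of \<open>S\<close>, because
  a nonzero one has positive trace. Pairing \<open>1 - \<psi> d\<close> with a trace-one matrix \<open>\<psi> x + 1/n\<close> gives
  \<open>1 - x \<bullet> d\<close>, so positivity of the corresponding functional says exactly that \<open>x\<close> lies in the polar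
  of \<open>D\<close>. The set \<open>D\<close> is compact, as positive semidefinite matrices of a fixed trace are bounded,
  and it has \<open>0\<close> in its interior, as small perturbations of the identity stay positive.

  The normal cones of a polar body are read off from \<open>D\<close>: with \<open>C\<close> the polar of a compact convex set
  \<open>D\<close> containing \<open>0\<close> in its interior, an outer normal \<open>u \<noteq> 0\<close> of \<open>C\<close> at \<open>x\<close> can be scaled so that
  \<open>u \<bullet> x = 1\<close>, and then \<open>u \<in> D\<close> by the bipolar theorem. Hence the normal cone at \<open>x\<close> is the cone over
  the exposed face \<open>{d \<in> D. x \<bullet> d = 1}\<close> (\<open>normal_cone_polar\<close>). A face of this cone is the cone
  over a face \<open>G\<close> of the exposed face, and \<open>G\<close> is a face of \<open>D\<close>. If \<open>G\<close> is again exposed in \<open>D\<close>,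
  say by \<open>a \<bullet> d = b\<close>, then \<open>b > 0\<close> and the cone over \<open>G\<close> is the normal cone at \<open>a / b\<close>. So the polar of
  \<open>D\<close> lies in the class as soon as all faces of \<open>D\<close> are exposed (\<open>polar_in_class_C''\<close>).

  It remains to see that affine sections of the cone of positive semidefinite matrices have only
  exposed faces (\<open>face_of_spectrahedron_exposed\<close>, a theorem of Ramana and Goldman). The face of a
  matrix is determined by its kernel \<open>K\<close>, and summing the values of the quadratic forms over a basis
  of \<open>K\<close> gives an affine functional that exposes the face.

  Finally, an identification exists because a real basis of the traceless hermitian matrices
  together with the identity is a complex basis of \<open>S\<close> (\<open>dim_traceless_hermitian\<close>).
\<close>

section \<open>Normal cones of polar bodies\<close>

definition polar :: "'a::euclidean_space set \<Rightarrow> 'a set"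
  where "polar D = {x. \<forall>d\<in>D. x \<bullet> d \<le> 1}"

text \<open>For \<open>x\<close> in the polar of \<open>D\<close> this is an exposed face of \<open>D\<close>; it is empty when \<open>x \<bullet> d < 1\<close>
  throughout \<open>D\<close>.\<close>

definition contact :: "'a::euclidean_space set \<Rightarrow> 'a \<Rightarrow> 'a set"
  where "contact D x = {d \<in> D. x \<bullet> d = 1}"

text \<open>A point outside \<open>D\<close> is strictly separated from \<open>D\<close> by a hyperplane. Since \<open>0 \<in> D\<close>, the
  hyperplane misses the origin and can be normalized to an element of the polar.\<close>

lemma bipolar:
  assumes "closed D" "convex D" "0 \<in> D"
  shows "polar (polar D) = D"
proof
  show "D \<subseteq> polar (polar D)"
    by (auto simp: polar_def inner_commute)
  show "polar (polar D) \<subseteq> D"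
  proof (rule ccontr)
    assume "\<not> polar (polar D) \<subseteq> D"
    then obtain p where p: "p \<in> polar (polar D)" "p \<notin> D" by blast
    obtain a b where ab: "a \<bullet> p < b" "\<forall>x\<in>D. a \<bullet> x > b"
      using separating_hyperplane_closed_point[OF assms(2,1) p(2)] by blast
    have b: "b < 0" using ab(2) assms(3) by force
    have "(1/b) *\<^sub>R a \<in> polar D"
      using ab(2) b by (auto simp: polar_def divide_simps intro: less_imp_le)
    then have "p \<bullet> ((1/b) *\<^sub>R a) \<le> 1" using p(1) unfolding polar_def[of "polar D"] by blast
    then show False using ab(1) b by (simp add: divide_simps inner_commute)
  qed
qed

lemma interior_polar:
  assumes "bounded D"
  shows "0 \<in> interior (polar D)"
proof -
  obtain B where B: "B > 0" "\<forall>d\<in>D. norm d \<le> B" using assms bounded_pos by blast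
  have "ball 0 (1/B) \<subseteq> polar D"
  proof
    fix x assume "x \<in> ball (0::'a) (1/B)"
    then have x: "norm x \<le> 1/B" by simp
    show "x \<in> polar D" unfolding polar_def
    proof safe
      fix d assume "d \<in> D"
      then have "norm x * norm d \<le> 1/B * B" using x B by (intro mult_mono) auto
      then show "x \<bullet> d \<le> 1" using norm_cauchy_schwarz[of x d] B(1) by simp
    qed
  qed
  then show ?thesis using B(1) by (meson centre_in_ball divide_pos_pos interior_maximal open_ball subsetD zero_less_one)
qed

lemma bounded_polar:
  assumes "0 \<in> interior D"
  shows "bounded (polar D)"
proof -
  obtain e where e: "e > 0" "cball 0 e \<subseteq> D" using assms mem_interior_cball by blast
  have "norm x \<le> 1 / e" if "x \<in> polar D" for x
  proof (cases "x = 0")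
    case False
    have "(e / norm x) *\<^sub>R x \<in> D" using e False by (intro subsetD[OF e(2)]) simp
    then have "x \<bullet> ((e / norm x) *\<^sub>R x) \<le> 1" using that by (auto simp: polar_def)
    then show ?thesis using False e(1)
      by (simp add: dot_square_norm divide_simps power2_eq_square mult.commute)
  qed (use e in simp)
  then show ?thesis using bounded_iff by blast
qed

lemma polar_eq_Inter: "polar D = (\<Inter>d\<in>D. {x. d \<bullet> x \<le> 1})"
  by (auto simp: polar_def inner_commute)

lemma convex_polar: "convex (polar D)"
  unfolding polar_eq_Inter by (intro convex_INT convex_halfspace_le)

lemma closed_polar: "closed (polar D)"
  unfolding polar_eq_Inter by (intro closed_INT ballI closed_halfspace_le)

text \<open>A nonzero outer normal \<open>u\<close> at \<open>x\<close> has \<open>u \<bullet> x > 0\<close>, as the polar body contains a ball around the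
  origin. Rescaled to \<open>u \<bullet> x = 1\<close> it is bounded by \<open>1\<close> on the polar body, so the bipolar theorem
  puts it into \<open>D\<close>. The origin is inserted because the cone hull of the empty set is empty.\<close>

lemma normal_cone_polar:
  assumes "closed D" "convex D" "bounded D" "0 \<in> D" and x: "x \<in> polar D"
  shows "normal_cone (polar D) x = insert 0 (cone hull contact D x)"
proof
  show "insert 0 (cone hull contact D x) \<subseteq> normal_cone (polar D) x"
    unfolding cone_hull_expl
    by (auto simp: normal_cone_def contact_def polar_def inner_diff_right inner_commute
        intro!: mult_left_le)
  show "normal_cone (polar D) x \<subseteq> insert 0 (cone hull contact D x)"
  proof
    fix u assume "u \<in> normal_cone (polar D) x"
    then have u: "u \<bullet> y \<le> u \<bullet> x" if "y \<in> polar D" for y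
      using that by (auto simp: normal_cone_def inner_diff_right)
    show "u \<in> insert 0 (cone hull contact D x)"
    proof (cases "u = 0")
      case False
      obtain e where e: "e > 0" "cball 0 e \<subseteq> polar D"
        using interior_polar[OF assms(3)] mem_interior_cball by blast
      have "(e / norm u) *\<^sub>R u \<in> polar D" using e False by (intro subsetD[OF e(2)]) simp
      from u[OF this] have h: "u \<bullet> x > 0" using False e(1)
        by (smt (verit) divide_pos_pos inner_gt_zero_iff inner_scaleR_right mult_pos_pos zero_less_norm_iff)
      define d where "d = (1 / (u \<bullet> x)) *\<^sub>R u"
      have "d \<in> polar (polar D)" using u h by (auto simp: polar_def d_def divide_simps)
      then have "d \<in> contact D x"
        using h bipolar[OF assms(1,2,4)] by (simp add: contact_def d_def inner_commute)
      moreover have "u = (u \<bullet> x) *\<^sub>R d" using h by (simp add: d_def)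
      ultimately show ?thesis using h unfolding cone_hull_expl
        by (metis (mono_tags, lifting) insertCI less_imp_le mem_Collect_eq)
    qed simp
  qed
qed

text \<open>A point \<open>f \<noteq> 0\<close> of a cone is interior to a segment of the ray through \<open>f\<close> that ends in any
  prescribed other point of that ray, so a face containing \<open>f\<close> contains the ray.\<close>

lemma face_of_cone_scale:
  assumes "cone N" "F face_of N" "f \<in> F" "t \<ge> 0"
  shows "t *\<^sub>R f \<in> F"
proof (cases "f = 0 \<or> t = 1")
  case True
  then show ?thesis using assms(3) by auto
next
  case False
  have fN: "f \<in> N" using assms(2,3) face_of_imp_subset by blast
  have N: "t *\<^sub>R f \<in> N" "(2 + t) *\<^sub>R f \<in> N" "0 *\<^sub>R f \<in> N"
    using assms(4) fN by (auto simp del: scaleR_zero_left intro!: mem_cone[OF assms(1)])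
  show ?thesis
  proof (cases "t < 1")
    case True
    \<comment> \<open>The weight \<open>(1 - t)/2\<close> solves \<open>(1 - w) t + w (2 + t) = 1\<close>.\<close>
    have "f = (1 - (1-t)/2) *\<^sub>R (t *\<^sub>R f) + ((1-t)/2) *\<^sub>R ((2 + t) *\<^sub>R f)"
      by (simp add: algebra_simps flip: scaleR_add_left scaleR_left_diff_distrib)
        (simp add: field_simps flip: scaleR_add_left)
    moreover have "0 < (1-t)/2" "(1-t)/2 < 1" using True assms(4) by auto
    moreover have "t *\<^sub>R f \<noteq> (2 + t) *\<^sub>R f" using False by simp
    ultimately have "f \<in> open_segment (t *\<^sub>R f) ((2 + t) *\<^sub>R f)"
      unfolding in_segment by blast
    then show ?thesis using face_ofD[OF assms(2) _ N(1,2) assms(3)] by blast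
  next
    case t: False
    then have t: "t > 1" using False by simp
    have "f = (1 - 1/t) *\<^sub>R (0 *\<^sub>R f) + (1/t) *\<^sub>R (t *\<^sub>R f)" using t by simp
    moreover have "0 < 1/t" "1/t < 1" using t by auto
    moreover have "0 *\<^sub>R f \<noteq> t *\<^sub>R f" using False t by simp
    ultimately have "f \<in> open_segment (0 *\<^sub>R f) (t *\<^sub>R f)"
      unfolding in_segment by blast
    then show ?thesis using face_ofD[OF assms(2) _ N(3,1) assms(3)] by blast
  qed
qed

lemma face_of_cone_hull:
  assumes "convex E" "F face_of insert 0 (cone hull E)" "F \<noteq> {}"
  shows "F = insert 0 (cone hull (F \<inter> E))" "(F \<inter> E) face_of E"
proof -
  let ?N = "insert 0 (cone hull E)"
  have N: "cone ?N"
    using cone_cone_hull[of E] by (auto simp: cone_def)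
  note scale = face_of_cone_scale[OF N assms(2)]
  have 0: "0 \<in> F" using assms(3) scale[of _ 0] by auto
  show "F = insert 0 (cone hull (F \<inter> E))"
  proof
    show "insert 0 (cone hull (F \<inter> E)) \<subseteq> F"
      using 0 scale unfolding cone_hull_expl by blast
    show "F \<subseteq> insert 0 (cone hull (F \<inter> E))"
    proof
      fix f assume f: "f \<in> F"
      then have "f \<in> ?N" using assms(2) face_of_imp_subset by blast
      then consider "f = 0" | c e where "f = c *\<^sub>R e" "c > 0" "e \<in> E"
        unfolding cone_hull_expl by (fastforce simp: less_le)
      then show "f \<in> insert 0 (cone hull (F \<inter> E))"
      proof cases
        case 2
        have "e = (1/c) *\<^sub>R f" using 2 by simp
        then have "e \<in> F" using scale[OF f, of "1/c"] 2(2) by simp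
        then show ?thesis using 2 unfolding cone_hull_expl by force
      qed simp
    qed
  qed
  have "?N \<inter> E = E" by (auto intro: hull_inc)
  then show "(F \<inter> E) face_of E"
    using face_of_slice[OF assms(2,1)] by simp
qed

text \<open>A face of the normal cone at \<open>x\<close> is the cone over a face \<open>G\<close> of \<open>contact D x\<close>. An empty \<open>G\<close>
  yields the cone \<open>{0}\<close>, which is the normal cone at the interior point \<open>0\<close>. A nonempty \<open>G\<close> is
  exposed in \<open>D\<close>, and its normalized exposing functional is the point of the polar body whose
  normal cone is sought.\<close>

lemma polar_in_class_C'':
  fixes D :: "'a::euclidean_space set"
  assumes D: "compact D" "convex D" "0 \<in> interior D"
    and exposed: "\<And>G. G face_of D \<Longrightarrow> G exposed_face_of D"
  shows "polar D \<in> class_C''"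
proof -
  have cl: "closed D" "bounded D" "0 \<in> D"
    using D compact_imp_closed compact_imp_bounded interior_subset by auto
  have int: "0 \<in> interior (polar D)" using interior_polar[OF cl(2)] .
  then have 0: "0 \<in> polar D" using interior_subset by blast
  note nc = normal_cone_polar[OF cl(1) D(2) cl(2,3)]
  have cpt: "compact (polar D)"
    using bounded_polar[OF D(3)] closed_polar compact_eq_bounded_closed by blast
  have "proper_convex (polar D)"
  proof -
    \<comment> \<open>Any nonzero linear form attains its maximum on a proper face, as the body has interior points.\<close>
    obtain a :: 'a where a: "a \<in> Basis" using nonempty_Basis by blast
    obtain x where x: "x \<in> polar D" "\<forall>y\<in>polar D. a \<bullet> y \<le> a \<bullet> x"
    proof -
      have "continuous_on (polar D) (\<lambda>y. a \<bullet> y)" by (intro continuous_intros)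
      then show thesis using continuous_attains_sup[OF cpt, of "\<lambda>y. a \<bullet> y"] 0 that by blast
    qed
    let ?F = "polar D \<inter> {y. a \<bullet> y = a \<bullet> x}"
    have "?F exposed_face_of polar D"
      using x(2) by (intro exposed_face_of_Int_supporting_hyperplane_le convex_polar) auto
    moreover have "x \<in> ?F" using x by simp
    moreover have "interior ?F \<subseteq> interior {y. a \<bullet> y = a \<bullet> x}" by (intro interior_mono) auto
    then have "?F \<noteq> polar D" using int a nonzero_Basis by fastforce
    ultimately show ?thesis using int convex_polar unfolding proper_convex_def by blast
  qed
  moreover have "F \<in> normal_cones (polar D)"
    if N: "proper_normal_cone (polar D) N" and F: "F face_of N" "F \<noteq> {}" for N F
  proof -
    obtain x where x: "x \<in> polar D" "N = normal_cone (polar D) x"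
      using N unfolding proper_normal_cone_def normal_cones_def by blast
    have E: "contact D x face_of D"
    proof -
      have "contact D x = D \<inter> {d. x \<bullet> d = 1}" by (auto simp: contact_def)
      moreover have "\<And>d. d \<in> D \<Longrightarrow> x \<bullet> d \<le> 1" using x(1) by (simp add: polar_def)
      ultimately show ?thesis using face_of_Int_supporting_hyperplane_le[OF D(2)] by metis
    qed
    define G where "G = F \<inter> contact D x"
    have FN: "F face_of insert 0 (cone hull contact D x)" using F x nc by simp
    note fc = face_of_cone_hull[OF face_of_imp_convex[OF E] FN F(2), folded G_def]
    have "\<exists>y\<in>polar D. G = contact D y"
    proof (cases "G = {}")
      case True
      then show ?thesis using 0 by (intro bexI[of _ 0]) (auto simp: contact_def)
    next
      case False
      obtain a b where ab: "D \<subseteq> {d. a \<bullet> d \<le> b}" "G = D \<inter> {d. a \<bullet> d = b}"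
        using exposed[OF face_of_trans[OF fc(2) E]] unfolding exposed_face_of_def by blast
      \<comment> \<open>The origin lies in \<open>D\<close> and not in \<open>G\<close>, so the exposing hyperplane misses it.\<close>
      have "b \<noteq> 0"
      proof
        assume b: "b = 0"
        then have "0 \<in> G" using ab(2) cl(3) by simp
        then show False by (simp add: G_def contact_def)
      qed
      then have b: "b > 0" using ab(1) cl(3) by force
      have "(1/b) *\<^sub>R a \<in> polar D" using ab(1) b by (auto simp: polar_def divide_simps)
      moreover have "G = contact D ((1/b) *\<^sub>R a)"
        using ab(2) b by (auto simp: contact_def divide_simps)
      ultimately show ?thesis by blast
    qed
    then obtain y where "y \<in> polar D" "G = contact D y" by blast
    then have "F = normal_cone (polar D) y" using fc(1) nc by simp
    then show ?thesis using \<open>y \<in> polar D\<close> by (simp add: normal_cones_def)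
  qed
  ultimately show ?thesis by (simp add: class_C''_def)
qed

section \<open>Faces of spectrahedra\<close>

text \<open>The form is nonnegative along the line \<open>x - s A x\<close>. As its value at \<open>x\<close> vanishes, so must its
  derivative \<open>-2 (A x \<bullet> A x)\<close> at \<open>s = 0\<close>.\<close>

lemma psd_quadratic_form_zero:
  fixes A :: "'b::real_inner \<Rightarrow> 'b"
  assumes A: "linear A" and sym: "\<And>x y. x \<bullet> A y = A x \<bullet> y"
    and psd: "\<And>x. 0 \<le> x \<bullet> A x" and x: "x \<bullet> A x = 0"
  shows "A x = 0"
proof (rule ccontr)
  assume "A x \<noteq> 0"
  define y where "y = A x"
  define q where "q = y \<bullet> A y"
  have y: "y \<bullet> y > 0" using \<open>A x \<noteq> 0\<close> by (simp add: y_def)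
  have q: "0 \<le> q" using psd by (simp add: q_def)
  \<comment> \<open>A step short enough for the linear term to beat the quadratic term \<open>s\<^sup>2 q\<close>; the summand \<open>1\<close>
    avoids a division by zero.\<close>
  define s where "s = (y \<bullet> y) / (q + 1)"
  have s: "s > 0" using y q by (simp add: s_def)
  have "0 \<le> (x - s *\<^sub>R y) \<bullet> A (x - s *\<^sub>R y)" by (rule psd)
  also have "\<dots> = s * (s * q - 2 * (y \<bullet> y))"
    using sym[of x y] x
    by (simp add: linear_diff[OF A] linear_scale[OF A] inner_diff_left inner_diff_right
        q_def y_def[symmetric] inner_commute algebra_simps)
  finally have "2 * (y \<bullet> y) \<le> s * q" using s by (simp add: zero_le_mult_iff)
  also have "s * q \<le> s * (q + 1)" using s by simp
  also have "\<dots> = y \<bullet> y" using q by (simp add: s_def)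
  finally show False using y by simp
qed

text \<open>On the unit sphere of the orthogonal complement of the kernel of \<open>A0\<close> the form of \<open>A0\<close> is
  positive, so by compactness the quotient of the two forms is bounded there. Components in the
  kernel contribute to neither form.\<close>

lemma psd_dominates_if_kernel_subset:
  fixes A A0 :: "'b::euclidean_space \<Rightarrow> 'b"
  assumes A0: "linear A0" "\<And>x y. x \<bullet> A0 y = A0 x \<bullet> y" "\<And>x. 0 \<le> x \<bullet> A0 x"
    and A: "linear A" "\<And>x y. x \<bullet> A y = A x \<bullet> y"
    and ker: "\<And>x. A0 x = 0 \<Longrightarrow> A x = 0"
  obtains c where "c > 0" "\<And>x. x \<bullet> A x \<le> c * (x \<bullet> A0 x)"
proof -
  let ?K = "{x. A0 x = 0}"
  have K: "subspace ?K" by (rule linear_subspace_kernel[OF A0(1)])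
  let ?T = "sphere 0 1 \<inter> {x. \<forall>k\<in>?K. x \<bullet> k = 0}"
  have T: "compact ?T"
  proof -
    have "{x. \<forall>k\<in>?K. x \<bullet> k = 0} = (\<Inter>k\<in>?K. {x. k \<bullet> x = 0})" by (auto simp: inner_commute)
    also have "closed \<dots>" by (intro closed_INT ballI closed_hyperplane)
    finally show ?thesis by (intro compact_Int_closed compact_sphere)
  qed
  have pos: "0 < x \<bullet> A0 x" if "x \<in> ?T" for x
  proof -
    have "x \<bullet> A0 x \<noteq> 0"
    proof
      assume "x \<bullet> A0 x = 0"
      then have "A0 x = 0" by (rule psd_quadratic_form_zero[OF A0])
      then have "x \<bullet> x = 0" using that by blast
      then show False using that by simp
    qed
    then show ?thesis using A0(3)[of x] by simp
  qed
  have cont: "continuous_on ?T (\<lambda>x. x \<bullet> f x)" if "linear f" for f :: "'b \<Rightarrow> 'b"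
    using that unfolding linear_conv_bounded_linear
    by (intro continuous_on_inner continuous_on_id linear_continuous_on)
  have "\<exists>c>0. \<forall>x\<in>?T. x \<bullet> A x \<le> c * (x \<bullet> A0 x)"
  proof (cases "?T = {}")
    case True then show ?thesis by (intro exI[of _ 1]) simp
  next
    case False
    have "continuous_on ?T (\<lambda>x. (x \<bullet> A x) / (x \<bullet> A0 x))"
      using pos by (intro continuous_on_divide cont A(1) A0(1)) force
    then obtain z where z: "\<And>x. x \<in> ?T \<Longrightarrow> (x \<bullet> A x) / (x \<bullet> A0 x) \<le> (z \<bullet> A z) / (z \<bullet> A0 z)"
      using continuous_attains_sup[OF T False] by blast
    let ?c = "max 1 ((z \<bullet> A z) / (z \<bullet> A0 z))"
    have "x \<bullet> A x \<le> ?c * (x \<bullet> A0 x)" if "x \<in> ?T" for x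
    proof -
      have "(x \<bullet> A x) / (x \<bullet> A0 x) \<le> ?c" using z[OF that] by simp
      then show ?thesis using pos[OF that] by (simp only: pos_divide_le_eq)
    qed
    then show ?thesis by (intro exI[of _ ?c]) auto
  qed
  then obtain c where c: "c > 0" "\<And>x. x \<in> ?T \<Longrightarrow> x \<bullet> A x \<le> c * (x \<bullet> A0 x)" by blast
  have "x \<bullet> A x \<le> c * (x \<bullet> A0 x)" for x
  proof -
    obtain k y where k: "k \<in> span ?K" and y: "\<And>w. w \<in> span ?K \<Longrightarrow> orthogonal y w"
      and x: "x = k + y"
      using orthogonal_subspace_decomp_exists[of ?K x] by metis
    have k0: "A0 k = 0" "A k = 0" using k ker K by (auto simp: span_eq_iff[THEN iffD2])
    have red: "x \<bullet> A0 x = y \<bullet> A0 y" "x \<bullet> A x = y \<bullet> A y"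
      using k0 A0(2)[of k y] A(2)[of k y]
      by (simp_all add: x linear_add[OF A0(1)] linear_add[OF A(1)] inner_add_left)
    show ?thesis
    proof (cases "y = 0")
      case True then show ?thesis using red linear_0[OF A(1)] linear_0[OF A0(1)] by simp
    next
      case False
      define u where "u = (1 / norm y) *\<^sub>R y"
      have "u \<in> ?T" using y False by (auto simp: u_def orthogonal_def span_base)
      then have "u \<bullet> A u \<le> c * (u \<bullet> A0 u)" by (rule c(2))
      moreover have "u \<bullet> A u = (y \<bullet> A y) / (norm y)\<^sup>2" "u \<bullet> A0 u = (y \<bullet> A0 y) / (norm y)\<^sup>2"
        by (simp_all add: u_def linear_scale[OF A0(1)] linear_scale[OF A(1)] power2_eq_square)
      ultimately show ?thesis using False red by (simp add: divide_simps split: if_splits)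
    qed
  qed
  then show ?thesis using c(1) that by blast
qed

text \<open>The solution set of the linear matrix inequality \<open>L d \<le> M\<close> in the Loewner order. Operators on a
  real inner product space are used in place of matrices; complex matrices fit in through the real
  part of the standard hermitian form.\<close>

definition spectrahedron ::
  "('b \<Rightarrow> 'b) \<Rightarrow> ('a::euclidean_space \<Rightarrow> 'b \<Rightarrow> 'b::euclidean_space) \<Rightarrow> 'a set"
  where "spectrahedron M L = {d. \<forall>x. x \<bullet> L d x \<le> x \<bullet> M x}"

text \<open>An intersection of half-spaces, so closed and convex.\<close>

lemma spectrahedron_eq_Inter:
  fixes L :: "'a::euclidean_space \<Rightarrow> 'b::euclidean_space \<Rightarrow> 'b"
  assumes L: "bilinear L"
  shows "spectrahedron M L = (\<Inter>x. {d. adjoint (\<lambda>d. x \<bullet> L d x) 1 \<bullet> d \<le> x \<bullet> M x})"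
proof -
  have "linear (\<lambda>d. x \<bullet> L d x)" for x
    using L by (auto simp: bilinear_def linear_iff inner_add_right)
  then have "adjoint (\<lambda>d. x \<bullet> L d x) 1 \<bullet> d = x \<bullet> L d x" for x d
    by (subst adjoint_clauses) auto
  then show ?thesis by (auto simp: spectrahedron_def)
qed

text \<open>Let \<open>g\<close> be a relative interior point of the face \<open>G\<close> and \<open>K\<close> the kernel of \<open>M - L g\<close>. Then \<open>G\<close>
  consists of the points \<open>d\<close> whose operator \<open>M - L d\<close> vanishes on \<open>K\<close>. Indeed, for \<open>d\<close> in \<open>G\<close> the segment
  from \<open>d\<close> to \<open>g\<close> extends beyond \<open>g\<close> within \<open>G\<close>, which forces the form of \<open>d\<close> to vanish where the form
  of \<open>g\<close> does. Conversely, if \<open>M - L d\<close> vanishes on \<open>K\<close>, its form is dominated by that of \<open>g\<close>, so the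
  segment from \<open>d\<close> to \<open>g\<close> extends beyond \<open>g\<close> within the spectrahedron, and the face property puts
  \<open>d\<close> into \<open>G\<close>. The sum of the values of the form over a basis of \<open>K\<close> is affine in \<open>d\<close>, nonnegative on
  the spectrahedron, and zero exactly on \<open>G\<close>.\<close>

lemma face_of_spectrahedron_exposed:
  fixes M :: "'b::euclidean_space \<Rightarrow> 'b" and L :: "'a::euclidean_space \<Rightarrow> 'b \<Rightarrow> 'b"
  assumes M: "linear M" "\<And>x y. x \<bullet> M y = M x \<bullet> y"
    and L: "bilinear L" "\<And>d x y. x \<bullet> L d y = L d x \<bullet> y"
    and G: "G face_of spectrahedron M L"
  shows "G exposed_face_of spectrahedron M L"
proof (cases "G = {}")
  case True then show ?thesis by simp
next
  case False
  let ?D = "spectrahedron M L"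
  define A where "A d x = M x - L d x" for d x
  have Ll: "linear (L d)" "linear (\<lambda>d. L d x)" for d x using L(1) by (auto simp: bilinear_def)
  have A: "linear (A d)" "x \<bullet> A d y = A d x \<bullet> y" for d x y
    using linear_compose_sub[OF M(1) Ll(1)] M(2) L(2)
    by (auto simp: A_def[abs_def] inner_diff_left inner_diff_right)
  have psd: "d \<in> ?D \<longleftrightarrow> (\<forall>x. 0 \<le> x \<bullet> A d x)" for d
    by (simp add: spectrahedron_def A_def inner_diff_right)
  have GD: "G \<subseteq> ?D" "convex G" using G face_of_imp_subset face_of_imp_convex by auto
  obtain g where g: "g \<in> rel_interior G" using False GD(2) rel_interior_eq_empty by blast
  then have gG: "g \<in> G" using rel_interior_subset by blast
  have Ag: "0 \<le> x \<bullet> A g x" for x using gG GD(1) psd by blast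
  have affine: "x \<bullet> A ((1 - t) *\<^sub>R d + t *\<^sub>R e) x = (1 - t) * (x \<bullet> A d x) + t * (x \<bullet> A e x)" for t d e x
    unfolding A_def linear_add[OF Ll(2)] linear_scale[OF Ll(2)]
    by (simp add: inner_diff_right inner_add_right algebra_simps)
  let ?K = "{x. A g x = 0}"
  have G_eq: "G = {d \<in> ?D. \<forall>x\<in>?K. A d x = 0}"
  proof (intro equalityI subsetI)
    fix d assume d: "d \<in> G"
    obtain e where e: "e > 1" "(1 - e) *\<^sub>R d + e *\<^sub>R g \<in> G"
      using convex_rel_interior_if2[OF GD(2) g] d hull_inc[of d G affine] by force
    have "A d x = 0" if "A g x = 0" for x
    proof (rule psd_quadratic_form_zero[OF A])
      have dp: "0 \<le> z \<bullet> A d z" for z using d GD(1) psd by blast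
      then show "0 \<le> z \<bullet> A d z" for z .
      have "0 \<le> x \<bullet> A ((1 - e) *\<^sub>R d + e *\<^sub>R g) x" using e(2) GD(1) psd by blast
      then have "0 \<le> (1 - e) * (x \<bullet> A d x)" using that by (simp only: affine) simp
      then show "x \<bullet> A d x = 0" using e(1) dp[of x] by (auto simp: zero_le_mult_iff)
    qed
    then show "d \<in> {d \<in> ?D. \<forall>x\<in>?K. A d x = 0}" using d GD(1) by auto
  next
    fix d assume "d \<in> {d \<in> ?D. \<forall>x\<in>?K. A d x = 0}"
    then have d: "d \<in> ?D" "\<And>x. A g x = 0 \<Longrightarrow> A d x = 0" by auto
    show "d \<in> G"
    proof (cases "d = g")
      case True then show ?thesis using gG by simp
    next
      case False
      obtain c where c: "c > 0" "\<And>x. x \<bullet> A d x \<le> c * (x \<bullet> A g x)"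
        using psd_dominates_if_kernel_subset[OF A(1) A(2) Ag A(1) A(2) d(2)] by blast
      \<comment> \<open>\<open>h\<close> lies on the line through \<open>d\<close> and \<open>g\<close> beyond \<open>g\<close>; domination by the factor \<open>c\<close> allows a step
        of relative length \<open>1 / c\<close>, and \<open>g\<close> then divides the segment from \<open>d\<close> to \<open>h\<close> with weight \<open>u\<close>.\<close>
      define t where "t = - 1 / c"
      define h where "h = (1 - t) *\<^sub>R g + t *\<^sub>R d"
      have hD: "h \<in> ?D" unfolding psd
      proof
        fix x
        have "x \<bullet> A h x = (x \<bullet> A g x) / c + (c * (x \<bullet> A g x) - x \<bullet> A d x) / c"
          using c(1) unfolding h_def affine t_def by (simp add: field_simps)
        then show "0 \<le> x \<bullet> A h x" using c Ag[of x] by simp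
      qed
      define u where "u = c / (1 + c)"
      have u: "0 < u" "u < 1" using c(1) by (auto simp: u_def)
      have "0 < c + c * c" using c(1) by (intro add_pos_pos mult_pos_pos)
      then have ut: "u * (1 - t) = 1" "1 - u + u * t = 0"
        using c(1) by (auto simp: u_def t_def field_simps)
      have "(1 - u) *\<^sub>R d + u *\<^sub>R h = (1 - u + u * t) *\<^sub>R d + (u * (1 - t)) *\<^sub>R g"
        by (simp add: h_def algebra_simps)
      then have "g = (1 - u) *\<^sub>R d + u *\<^sub>R h" using ut by simp
      moreover from this have "d \<noteq> h" using False by (auto simp flip: scaleR_add_left)
      ultimately have "g \<in> open_segment d h" using u unfolding in_segment by blast
      then show ?thesis using face_ofD[OF G _ d(1) hD gG] by blast
    qed
  qed
  obtain B where B: "B \<subseteq> ?K" "independent B" "?K \<subseteq> span B" by (rule basis_exists)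
  have fB: "finite B" using B(2) independent_imp_finite by blast
  define f where "f d = (\<Sum>b\<in>B. b \<bullet> L d b)" for d
  define v where "v = adjoint f 1"
  define \<beta> where "\<beta> = (\<Sum>b\<in>B. b \<bullet> M b)"
  have "linear f"
    using Ll(2) by (auto simp: f_def linear_iff inner_add_right sum.distrib sum_distrib_left)
  then have v: "v \<bullet> d = f d" for d by (simp add: v_def adjoint_clauses)
  have gap: "\<beta> - v \<bullet> d = (\<Sum>b\<in>B. b \<bullet> A d b)" for d
    by (simp add: v f_def \<beta>_def A_def inner_diff_right sum_subtractf)
  have "(\<forall>x\<in>?K. A d x = 0) \<longleftrightarrow> v \<bullet> d = \<beta>" if d: "d \<in> ?D" for d
  proof -
    have nn: "0 \<le> x \<bullet> A d x" for x using d psd by blast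
    have "v \<bullet> d = \<beta> \<longleftrightarrow> (\<Sum>b\<in>B. b \<bullet> A d b) = 0" using gap[of d] by auto
    also have "\<dots> \<longleftrightarrow> (\<forall>b\<in>B. b \<bullet> A d b = 0)" using nn fB by (intro sum_nonneg_eq_0_iff) auto
    also have "\<dots> \<longleftrightarrow> (\<forall>b\<in>B. A d b = 0)" using psd_quadratic_form_zero[OF A nn] by auto
    also have "\<dots> \<longleftrightarrow> (\<forall>x\<in>?K. A d x = 0)"
    proof
      assume 0: "\<forall>b\<in>B. A d b = 0"
      have "span B \<subseteq> {x. A d x = 0}"
        using 0 by (intro span_minimal linear_subspace_kernel A(1)) auto
      then show "\<forall>x\<in>?K. A d x = 0" using B(3) by blast
    qed (use B(1) in blast)
    finally show ?thesis by simp
  qed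
  then have "G = ?D \<inter> {d. v \<bullet> d = \<beta>}" using G_eq by auto
  moreover have "v \<bullet> d \<le> \<beta>" if "d \<in> ?D" for d
  proof -
    have "0 \<le> (\<Sum>b\<in>B. b \<bullet> A d b)" using that psd by (intro sum_nonneg) auto
    then show ?thesis using gap[of d] by simp
  qed
  ultimately show ?thesis using G unfolding exposed_face_of_def by (auto intro!: exI[of _ v] exI[of _ \<beta>])
qed

section \<open>Hermitian matrices as real quadratic forms\<close>

lemma conj_transpose_nth [simp]: "conj_transpose A $ i $ j = cnj (A $ j $ i)"
  by (simp add: conj_transpose_def)

lemma cscale_nth [simp]: "cscale c A $ i $ j = c * A $ i $ j"
  by (simp add: cscale_def)

lemma scaleR_eq_cscale: "r *\<^sub>R A = cscale (complex_of_real r) A"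
  by (simp add: vec_eq_iff scaleR_conv_of_real[where 'a = complex])

lemma conj_transpose_simps [simp]:
  "conj_transpose (A + B) = conj_transpose A + conj_transpose B"
  "conj_transpose (A - B) = conj_transpose A - conj_transpose B"
  "conj_transpose (cscale c A) = cscale (cnj c) (conj_transpose A)"
  "conj_transpose (conj_transpose A) = A"
  "conj_transpose (mat 1) = mat 1"
  by (auto simp: vec_eq_iff mat_def)

lemma hermitian_closed:
  "hermitian (mat 1)"
  "hermitian A \<Longrightarrow> hermitian B \<Longrightarrow> hermitian (A + B)"
  "hermitian A \<Longrightarrow> hermitian B \<Longrightarrow> hermitian (A - B)"
  "hermitian A \<Longrightarrow> hermitian (r *\<^sub>R A)"
  by (simp_all add: hermitian_def scaleR_eq_cscale)

lemma hs_inner_sum: "hs_inner a b = (\<Sum>i\<in>UNIV. \<Sum>j\<in>UNIV. cnj (a $ i $ j) * b $ i $ j)"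
  unfolding hs_inner_def trace_def matrix_matrix_mult_def by (simp, rule sum.swap)

lemma hs_inner_simps:
  "hs_inner a (b + c) = hs_inner a b + hs_inner a c"
  "hs_inner (a - c) b = hs_inner a b - hs_inner c b"
  "hs_inner a (cscale t b) = t * hs_inner a b"
  "hs_inner a (mat 1) = cnj (trace a)"
  "hs_inner (mat 1) b = trace b"
  "hs_inner (conj_transpose a) (conj_transpose b) = cnj (hs_inner a b)"
proof -
  show "hs_inner (conj_transpose a) (conj_transpose b) = cnj (hs_inner a b)"
    unfolding hs_inner_sum cnj_sum by (subst sum.swap) simp
qed (simp_all add: hs_inner_sum algebra_simps sum.distrib sum_subtractf sum_distrib_left
      mat_def trace_def if_distrib if_distribR cong: if_cong)

text \<open>Through this equation and its refinement for hermitian matrices, every pairing below becomes a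
  real inner product of the Euclidean space of matrices.\<close>

lemma Re_hs_inner: "Re (hs_inner a b) = a \<bullet> b"
  by (simp add: hs_inner_sum inner_vec_def inner_complex_def)

lemma hs_inner_hermitian:
  assumes "hermitian a" "hermitian b"
  shows "hs_inner a b = complex_of_real (a \<bullet> b)"
proof -
  have "cnj (hs_inner a b) = hs_inner a b"
    using hs_inner_simps(6)[of a b] assms by (simp add: hermitian_def)
  then have "hs_inner a b = complex_of_real (Re (hs_inner a b))"
    by (metis Reals_cnj_iff of_real_Re)
  then show ?thesis by (simp add: Re_hs_inner)
qed

lemma trace_hermitian:
  assumes "hermitian a"
  shows "trace a = complex_of_real (mat 1 \<bullet> a)"
  using hs_inner_hermitian[OF hermitian_closed(1) assms] by (simp add: hs_inner_simps)

lemma inner_mat_1_mat_1: "(mat 1 :: complex^'n^'n) \<bullet> mat 1 = real CARD('n)"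
  using trace_hermitian[of "mat 1 :: complex^'n^'n"] hermitian_closed(1)
  by (metis trace_I of_real_eq_iff of_real_of_nat_eq)

lemma inner_matrix_vector_adjoint:
  fixes A :: "complex^'n^'n"
  shows "x \<bullet> (A *v y) = (conj_transpose A *v x) \<bullet> y"
proof -
  have c: "a \<bullet> (b * c) = (cnj b * a) \<bullet> c" for a b c :: complex
    by (simp add: inner_complex_def algebra_simps)
  have "x \<bullet> (A *v y) = (\<Sum>i\<in>UNIV. \<Sum>j\<in>UNIV. x $ i \<bullet> (A $ i $ j * y $ j))"
    by (simp add: inner_vec_def matrix_vector_mult_def inner_sum_right)
  also have "\<dots> = (\<Sum>j\<in>UNIV. \<Sum>i\<in>UNIV. (cnj (A $ i $ j) * x $ i) \<bullet> y $ j)"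
    unfolding c by (rule sum.swap)
  also have "\<dots> = (conj_transpose A *v x) \<bullet> y"
    by (simp add: inner_vec_def matrix_vector_mult_def inner_sum_left)
  finally show ?thesis .
qed

text \<open>For hermitian matrices the hermitian form is real-valued, hence equal to the real quadratic form
  of the Euclidean space \<open>complex^'n\<close>.\<close>

lemma pos_semidef_iff:
  "pos_semidef A \<longleftrightarrow> hermitian A \<and> (\<forall>x. 0 \<le> x \<bullet> (A *v x))"
proof -
  have "(\<Sum>i\<in>UNIV. cnj (x $ i) * (A *v x) $ i) = complex_of_real (x \<bullet> (A *v x))"
    if "hermitian A" for x
  proof (rule complex_eqI)
    show "Re (\<Sum>i\<in>UNIV. cnj (x $ i) * (A *v x) $ i) = Re (complex_of_real (x \<bullet> (A *v x)))"
      by (simp add: inner_vec_def inner_complex_def)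
    have A: "cnj (A $ j $ i) = A $ i $ j" for i j
      using that by (metis hermitian_def conj_transpose_nth)
    have "cnj (\<Sum>i\<in>UNIV. cnj (x $ i) * (A *v x) $ i)
        = (\<Sum>i\<in>UNIV. \<Sum>j\<in>UNIV. x $ i * (A $ j $ i * cnj (x $ j)))"
      by (simp add: matrix_vector_mult_def sum_distrib_left A)
    also have "\<dots> = (\<Sum>i\<in>UNIV. cnj (x $ i) * (A *v x) $ i)"
      by (subst sum.swap) (simp add: matrix_vector_mult_def sum_distrib_left mult_ac)
    finally show "Im (\<Sum>i\<in>UNIV. cnj (x $ i) * (A *v x) $ i) = Im (complex_of_real (x \<bullet> (A *v x)))"
      unfolding complex_eq_iff cnj.sel Im_complex_of_real by linarith
  qed
  then show ?thesis by (auto simp: pos_semidef_def)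
qed

lemma matrix_vector_mult_scaleR: "(r *\<^sub>R A) *v x = r *\<^sub>R (A *v (x::complex^'n))"
  by (simp add: vec_eq_iff matrix_vector_mult_def scaleR_sum_right)

lemma bilinear_matrix_vector:
  fixes \<psi> :: "'a::real_vector \<Rightarrow> complex^'n^'m"
  assumes "linear \<psi>"
  shows "bilinear (\<lambda>d. (*v) (\<psi> d))"
  unfolding bilinear_def
  by (auto intro!: linearI simp: linear_add[OF assms] linear_scale[OF assms]
      matrix_vector_mult_add_rdistrib matrix_vector_mult_scaleR)

text \<open>The entries of a positive semidefinite matrix satisfy \<open>2 |p i j| \<le> p i i + p j j\<close>: test the form
  on \<open>e i + c e j\<close>, where the phase \<open>c\<close> turns the off-diagonal entry into \<open>- |p i j|\<close>. So the
  positive semidefinite matrices of a fixed trace form a bounded set.\<close>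

lemma norm_le_trace_if_pos_semidef:
  fixes p :: "complex^'n^'n"
  assumes "pos_semidef p"
  shows "norm p \<le> (real CARD('n))\<^sup>2 * (mat 1 \<bullet> p)"
proof -
  have herm: "hermitian p" and psd: "0 \<le> x \<bullet> (p *v x)" for x
    using assms by (auto simp: pos_semidef_iff)
  have hp: "p $ j $ i = cnj (p $ i $ j)" for i j
    using herm by (metis hermitian_def conj_transpose_nth)
  have ax: "axis i a \<bullet> (p *v axis j b) = a \<bullet> (p $ i $ j * b)" for i j a b
  proof -
    have "(p *v axis j b) $ i = p $ i $ j * b"
      by (simp add: matrix_vector_mult_def axis_def if_distrib cong: if_cong)
    then show ?thesis by (simp add: inner_axis')
  qed
  have diag: "0 \<le> Re (p $ i $ i)" for i
    using psd[of "axis i 1"] by (simp add: ax inner_complex_def)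
  have tr: "mat 1 \<bullet> p = (\<Sum>i\<in>UNIV. Re (p $ i $ i))"
    using trace_hermitian[OF herm] by (metis Re_complex_of_real Re_sum trace_def)
  have entry: "norm (p $ i $ j) \<le> mat 1 \<bullet> p" for i j
  proof -
    define c where "c = - cnj (sgn (p $ i $ j))"
    have pc: "p $ i $ j * c = - complex_of_real (norm (p $ i $ j))"
      by (simp add: c_def sgn_eq complex_norm_square[symmetric] power2_eq_square field_simps)
    have "0 \<le> (axis i 1 + axis j c) \<bullet> (p *v (axis i 1 + axis j c))" by (rule psd)
    also have "\<dots> = Re (p $ i $ i) + 1 \<bullet> (p $ i $ j * c) + c \<bullet> p $ j $ i + c \<bullet> (p $ j $ j * c)"
      by (simp add: matrix_vector_right_distrib inner_add_left inner_add_right ax inner_complex_def)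
    also have "c \<bullet> p $ j $ i = 1 \<bullet> (p $ i $ j * c)"
      by (simp add: hp[of j i] inner_complex_def)
    also have "1 \<bullet> (p $ i $ j * c) = - norm (p $ i $ j)" by (simp add: pc inner_complex_def)
    also have "c \<bullet> (p $ j $ j * c) = (norm c)\<^sup>2 * Re (p $ j $ j)"
      unfolding cmod_power2 by (simp add: inner_complex_def power2_eq_square algebra_simps)
    also have "\<dots> \<le> Re (p $ j $ j)"
      using diag[of j] by (intro mult_left_le_one_le) (auto simp: c_def norm_sgn)
    finally have "2 * norm (p $ i $ j) \<le> Re (p $ i $ i) + Re (p $ j $ j)" by simp
    moreover have "Re (p $ k $ k) \<le> mat 1 \<bullet> p" for k
      unfolding tr using diag by (intro member_le_sum) auto
    ultimately show ?thesis by (smt (verit))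
  qed
  have "norm p \<le> (\<Sum>i\<in>UNIV. norm (p $ i))" unfolding norm_vec_def[of p] by (intro L2_set_le_sum) simp
  also have "\<dots> \<le> (\<Sum>i\<in>UNIV. \<Sum>j\<in>UNIV. norm (p $ i $ j))"
    by (intro sum_mono) (simp add: norm_vec_def L2_set_le_sum)
  also have "\<dots> \<le> (\<Sum>i\<in>(UNIV::'n set). \<Sum>j\<in>(UNIV::'n set). mat 1 \<bullet> p)"
    by (intro sum_mono entry)
  also have "\<dots> = (real CARD('n))\<^sup>2 * (mat 1 \<bullet> p)" by (simp add: power2_eq_square)
  finally show ?thesis .
qed

section \<open>State spaces of operator systems\<close>

context
  fixes S :: "(complex^'n^'n) set"
  assumes S: "operator_system S"
begin

lemma operator_system_closed:
  "mat 1 \<in> S" "s \<in> S \<Longrightarrow> conj_transpose s \<in> S" "s \<in> S \<Longrightarrow> t \<in> S \<Longrightarrow> s + t \<in> S"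
  "s \<in> S \<Longrightarrow> t \<in> S \<Longrightarrow> s - t \<in> S" "s \<in> S \<Longrightarrow> cscale c s \<in> S" "s \<in> S \<Longrightarrow> r *\<^sub>R s \<in> S"
proof -
  have sub: "cmat.subspace S" using S by (simp add: operator_system_def)
  show "mat 1 \<in> S" "s \<in> S \<Longrightarrow> conj_transpose s \<in> S" using S by (simp_all add: operator_system_def)
  show "s \<in> S \<Longrightarrow> t \<in> S \<Longrightarrow> s + t \<in> S" by (rule cmat.subspace_add[OF sub])
  show "s \<in> S \<Longrightarrow> t \<in> S \<Longrightarrow> s - t \<in> S" by (rule cmat.subspace_diff[OF sub])
  show scale: "s \<in> S \<Longrightarrow> cscale c s \<in> S" for c by (rule cmat.subspace_scale[OF sub])
  show "s \<in> S \<Longrightarrow> r *\<^sub>R s \<in> S" unfolding scaleR_eq_cscale by (rule scale)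
qed

text \<open>A state takes real values on hermitian matrices \<open>t\<close>, because \<open>t + K 1\<close> is positive semidefinite for
  large \<open>K\<close>. Applied to \<open>\<i> (s - s\<^sup>*)\<close>, this makes the norm of \<open>s - s\<^sup>*\<close> vanish.\<close>

lemma hermitian_if_state:
  assumes s: "s \<in> S" and state: "is_state S (hs_inner s)"
  shows "hermitian s"
proof -
  have real: "Im (hs_inner s t) = 0" if t: "t \<in> S" "hermitian t" for t
  proof -
    have "bounded_linear ((*v) t)" by (simp add: linear_conv_bounded_linear[symmetric])
    then obtain K where K: "norm (t *v x) \<le> norm x * K" for x
      using bounded_linear.bounded by blast
    have "pos_semidef (t + K *\<^sub>R mat 1)" unfolding pos_semidef_iff
    proof safe
      show "hermitian (t + K *\<^sub>R mat 1)" using t by (intro hermitian_closed)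
      fix x
      have "- (x \<bullet> (t *v x)) \<le> norm x * norm (t *v x)"
        using norm_cauchy_schwarz[of "-x" "t *v x"] by simp
      also have "\<dots> \<le> norm x * (norm x * K)" by (intro mult_left_mono K) simp
      also have "\<dots> = K * (x \<bullet> x)" by (simp add: dot_square_norm power2_eq_square)
      finally show "0 \<le> x \<bullet> ((t + K *\<^sub>R mat 1) *v x)"
        by (simp add: matrix_vector_mult_add_rdistrib matrix_vector_mult_scaleR inner_add_right)
    qed
    moreover have "t + K *\<^sub>R mat 1 \<in> S" by (intro operator_system_closed t(1))
    ultimately have "hs_inner s (t + K *\<^sub>R mat 1) \<in> \<real>\<^sub>\<ge>\<^sub>0"
      using state by (simp add: is_state_def)
    moreover have "hs_inner s (mat 1) = 1" using state by (simp add: is_state_def)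
    ultimately show ?thesis
      by (simp add: scaleR_eq_cscale hs_inner_simps(1,3) complex_nonneg_Reals_iff)
  qed
  define e where "e = s - conj_transpose s"
  define k where "k = cscale \<i> e"
  have e: "conj_transpose e = - e" by (simp add: e_def)
  have k: "k \<in> S" "conj_transpose k = k"
    using s by (simp_all add: k_def e_def operator_system_closed) (simp add: vec_eq_iff algebra_simps)
  have "hs_inner (conj_transpose s) k = cnj (hs_inner s k)"
    using hs_inner_simps(6)[of s k] k(2) by simp
  also have "\<dots> = hs_inner s k" using real k by (simp add: complex_eq_iff hermitian_def)
  finally have "hs_inner e k = 0" by (simp add: e_def hs_inner_simps(2))
  then have "hs_inner e e = 0" by (simp add: k_def hs_inner_simps(3))
  then have "e \<bullet> e = 0" using Re_hs_inner[of e e] by simp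
  then show ?thesis by (simp add: e_def hermitian_def)
qed

lemma state_space_iff:
  "s \<in> state_space S \<longleftrightarrow> s \<in> S \<and> hermitian s \<and> trace s = 1 \<and>
    (\<forall>p\<in>S. pos_semidef p \<longrightarrow> 0 \<le> s \<bullet> p)"
proof
  assume "s \<in> state_space S"
  then have s: "s \<in> S" "is_state S (hs_inner s)" by (auto simp: state_space_def)
  have "cnj (trace s) = 1" using s(2) by (simp add: is_state_def hs_inner_simps(4))
  then have "trace s = 1" by (metis complex_cnj_cnj complex_cnj_one)
  moreover have "0 \<le> s \<bullet> p" if "p \<in> S" "pos_semidef p" for p
    using s(2) that by (auto simp: is_state_def complex_nonneg_Reals_iff Re_hs_inner)
  ultimately show "s \<in> S \<and> hermitian s \<and> trace s = 1 \<and>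
      (\<forall>p\<in>S. pos_semidef p \<longrightarrow> 0 \<le> s \<bullet> p)"
    using s hermitian_if_state by blast
next
  assume s: "s \<in> S \<and> hermitian s \<and> trace s = 1 \<and> (\<forall>p\<in>S. pos_semidef p \<longrightarrow> 0 \<le> s \<bullet> p)"
  then show "s \<in> state_space S"
    by (simp add: state_space_def is_state_def hs_inner_simps(1,3,4) pos_semidef_def
        hs_inner_hermitian complex_nonneg_Reals_iff)
qed

lemma subspace_traceless_hermitian: "subspace (traceless_hermitian S)"
proof -
  have eq: "traceless_hermitian S = {s \<in> S. hermitian s \<and> mat 1 \<bullet> s = 0}"
    by (auto simp: traceless_hermitian_def trace_hermitian)
  have "0 \<in> S" using operator_system_closed(4)[OF operator_system_closed(1,1)] by simp
  moreover have "hermitian (0 :: complex^'n^'n)"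
    using hermitian_closed(3)[OF hermitian_closed(1,1)] by simp
  ultimately show ?thesis
    unfolding eq subspace_def
    by (simp add: inner_add_right operator_system_closed(3,6) hermitian_closed(2,4))
qed

lemma decompose_hermitian:
  assumes "s \<in> S" "hermitian s"
  obtains v where "v \<in> traceless_hermitian S" "s = ((mat 1 \<bullet> s) / real CARD('n)) *\<^sub>R mat 1 + v"
proof
  let ?v = "s - ((mat 1 \<bullet> s) / real CARD('n)) *\<^sub>R mat 1"
  have h: "hermitian ?v" using assms by (intro hermitian_closed)
  have "trace ?v = 0"
    by (simp add: trace_hermitian[OF h] inner_diff_right inner_mat_1_mat_1)
  then show "?v \<in> traceless_hermitian S"
    using h assms by (simp add: traceless_hermitian_def operator_system_closed)
qed simp

text \<open>A real basis of the traceless hermitian part, with the identity added, is a complex basis of \<open>S\<close>. It is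
  linearly independent over the complex numbers since taking hermitian and antihermitian parts splits a
  complex relation between hermitian matrices into two real ones; it spans since every element is
  \<open>h + \<i> k\<close> with hermitian \<open>h\<close> and \<open>k\<close> in \<open>S\<close>.\<close>

lemma dim_traceless_hermitian: "cmat.dim S = dim (traceless_hermitian S) + 1"
proof -
  let ?V = "traceless_hermitian S"
  obtain B where B: "B \<subseteq> ?V" "independent B" "?V \<subseteq> span B" "card B = dim ?V"
    by (rule basis_exists)
  have fB: "finite B" using B(2) independent_imp_finite by blast
  have Vh: "hermitian b" "mat 1 \<bullet> b = 0" "b \<in> S" if "b \<in> ?V" for b
    using that trace_hermitian[of b] by (auto simp: traceless_hermitian_def)
  have V1: "span B \<subseteq> ?V" using B(1) subspace_traceless_hermitian span_minimal by blast
  have I: "mat 1 \<notin> span B"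
  proof
    assume "(mat 1 :: complex^'n^'n) \<in> span B"
    then have "(mat 1 :: complex^'n^'n) \<bullet> mat 1 = 0" using V1 Vh(2) by blast
    then show False by (simp add: inner_mat_1_mat_1)
  qed
  define T where "T = insert (mat 1) B"
  have "mat 1 \<notin> B" using I span_base by blast
  then have T: "independent T" "finite T" "card T = dim ?V + 1"
    using I B(2,4) fB by (simp_all add: T_def independent_insert)
  have Th: "hermitian b" "b \<in> S" if "b \<in> T" for b
    using that Vh(1,3) B(1) hermitian_closed(1) operator_system_closed(1)
    unfolding T_def by blast+
  have "cmat.independent T"
  proof (rule cmat.independent_if_scalars_zero[OF T(2)])
    fix c b assume 0: "(\<Sum>b\<in>T. cscale (c b) b) = 0" and b: "b \<in> T"
    have ent: "(\<Sum>b\<in>T. c b * b $ i $ j) = 0" for i j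
      using arg_cong[OF 0, of "\<lambda>A. A $ i $ j"] by simp
    have ent': "(\<Sum>b\<in>T. cnj (c b) * b $ i $ j) = 0" for i j
    proof -
      have "(\<Sum>b\<in>T. cnj (c b) * b $ i $ j) = cnj (\<Sum>b\<in>T. c b * b $ j $ i)"
        unfolding cnj_sum using Th(1)
        by (intro sum.cong) (auto simp: hermitian_def, metis conj_transpose_nth)
      then show ?thesis by (simp add: ent)
    qed
    have re: "of_real (Re z) = (z + cnj z) / 2" and im: "of_real (Im z) = (z - cnj z) / (2 * \<i>)" for z
      by (auto simp: complex_eq_iff)
    have "(\<Sum>b\<in>T. Re (c b) *\<^sub>R b) $ i $ j = 0" for i j
      using ent[of i j] ent'[of i j]
      unfolding sum_component vector_scaleR_component scaleR_conv_of_real[where 'a = complex] re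
      by (simp add: sum.distrib algebra_simps add_divide_distrib flip: sum_divide_distrib)
    then have "(\<Sum>b\<in>T. Re (c b) *\<^sub>R b) = 0" by (simp add: vec_eq_iff)
    then have "Re (c b) = 0"
      using independentD[OF T(1,2) subset_refl _ b, of "\<lambda>b. Re (c b)"] by simp
    moreover have "(\<Sum>b\<in>T. Im (c b) *\<^sub>R b) $ i $ j = 0" for i j
      using ent[of i j] ent'[of i j]
      unfolding sum_component vector_scaleR_component scaleR_conv_of_real[where 'a = complex] im
      by (simp add: sum_subtractf algebra_simps diff_divide_distrib flip: sum_divide_distrib)
    then have "(\<Sum>b\<in>T. Im (c b) *\<^sub>R b) = 0" by (simp add: vec_eq_iff)
    then have "Im (c b) = 0"
      using independentD[OF T(1,2) subset_refl _ b, of "\<lambda>b. Im (c b)"] by simp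
    ultimately show "c b = 0" by (simp add: complex_eq_iff)
  qed
  moreover have "S \<subseteq> cmat.span T"
  proof
    have "span T \<subseteq> cmat.span T"
    proof (rule span_minimal)
      show "T \<subseteq> cmat.span T" by (rule cmat.span_superset)
      show "subspace (cmat.span T)"
        by (auto simp: subspace_def scaleR_eq_cscale cmat.span_zero cmat.span_add cmat.span_scale)
    qed
    moreover have "s \<in> span T" if s: "s \<in> S" "hermitian s" for s
    proof -
      obtain v where v: "v \<in> ?V" "s = ((mat 1 \<bullet> s) / real CARD('n)) *\<^sub>R mat 1 + v"
        using decompose_hermitian[OF s] .
      have "v \<in> span T" using v(1) B(3) span_mono[of B T] by (auto simp: T_def)
      moreover have "mat 1 \<in> span T" by (simp add: T_def span_base)
      ultimately show ?thesis by (subst v(2)) (intro span_add span_scale)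
    qed
    ultimately have herm: "s \<in> cmat.span T" if "s \<in> S" "hermitian s" for s using that by blast
    fix s assume s: "s \<in> S"
    let ?h = "cscale (1/2) (s + conj_transpose s)" and ?k = "cscale (- \<i>/2) (s - conj_transpose s)"
    have "?h \<in> S" "?k \<in> S" by (intro operator_system_closed s)+
    moreover have "hermitian ?h" "hermitian ?k" by (auto simp: hermitian_def vec_eq_iff algebra_simps)
    ultimately have "?h \<in> cmat.span T" "?k \<in> cmat.span T" using herm by auto
    then have "?h + cscale \<i> ?k \<in> cmat.span T" by (rule cmat.span_add[OF _ cmat.span_scale])
    also have "?h + cscale \<i> ?k = s" by (simp add: vec_eq_iff algebra_simps)
    finally show "s \<in> cmat.span T" .
  qed
  ultimately show ?thesis using cmat.dim_unique[of T S] Th(2) T(3) by auto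
qed

lemma ex_hs_identification:
  assumes "CARD('m) = cmat.dim S - 1"
  shows "\<exists>\<psi> :: real^'m \<Rightarrow> complex^'n^'n. hs_identification (traceless_hermitian S) \<psi>"
proof -
  have "dim (UNIV :: (real^'m) set) = dim (traceless_hermitian S)"
    using assms dim_traceless_hermitian by simp
  then obtain \<psi> :: "real^'m \<Rightarrow> complex^'n^'n" where \<psi>: "linear \<psi>" "range \<psi> = traceless_hermitian S"
    "\<And>x. norm (\<psi> x) = norm x"
    using isometry_subspaces[OF subspace_UNIV subspace_traceless_hermitian] by (metis UNIV_I)
  have "\<psi> x \<bullet> \<psi> y = x \<bullet> y" for x y
    using \<psi>(3) by (simp add: dot_norm flip: linear_add[OF \<psi>(1)])
  moreover have "hermitian (\<psi> x)" for x
    using \<psi>(2) unfolding traceless_hermitian_def by blast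
  ultimately show ?thesis
    using \<psi>(1,2) by (auto simp: hs_identification_def hs_inner_hermitian)
qed

context
  fixes \<psi> :: "'a::euclidean_space \<Rightarrow> complex^'n^'n"
  assumes lin: "linear \<psi>" and range: "range \<psi> = traceless_hermitian S"
    and iso: "\<And>x y. \<psi> x \<bullet> \<psi> y = x \<bullet> y"
begin

text \<open>The body whose polar is the translated state space: the points \<open>d\<close> for which \<open>1 - \<psi> d\<close> is positive
  semidefinite. Since all these matrices have trace \<open>n\<close>, it is the reflected slice of the positive
  semidefinite cone of \<open>S\<close> by a hyperplane of fixed trace.\<close>

abbreviation "psd_slice \<equiv> spectrahedron (\<lambda>x. x) (\<lambda>d. (*v) (\<psi> d))"

lemma identification_image: "\<psi> d \<in> S" "hermitian (\<psi> d)" "mat 1 \<bullet> \<psi> d = 0"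
proof -
  have "\<psi> d \<in> traceless_hermitian S" using range by blast
  then show "\<psi> d \<in> S" "hermitian (\<psi> d)" "mat 1 \<bullet> \<psi> d = 0"
    using trace_hermitian[of "\<psi> d"] by (auto simp: traceless_hermitian_def)
qed

lemma mem_psd_slice_iff: "d \<in> psd_slice \<longleftrightarrow> pos_semidef (mat 1 - \<psi> d)"
  by (simp add: spectrahedron_def pos_semidef_iff hermitian_closed identification_image
      matrix_vector_mult_diff_rdistrib inner_diff_right)

lemma compact_psd_slice: "compact psd_slice"
proof -
  note bil = bilinear_matrix_vector[OF lin]
  have "closed psd_slice"
    unfolding spectrahedron_eq_Inter[OF bil] by (intro closed_INT ballI closed_halfspace_le)
  moreover have "bounded psd_slice"
  proof (rule boundedI)
    fix d assume "d \<in> psd_slice"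
    then have "norm (mat 1 - \<psi> d) \<le> (real CARD('n))\<^sup>2 * (mat 1 \<bullet> (mat 1 - \<psi> d))"
      unfolding mem_psd_slice_iff by (rule norm_le_trace_if_pos_semidef)
    also have "\<dots> = (real CARD('n))\<^sup>2 * real CARD('n)"
      by (simp add: inner_diff_right identification_image inner_mat_1_mat_1)
    finally have "norm (\<psi> d) \<le> norm (mat 1 :: complex^'n^'n) + (real CARD('n))\<^sup>2 * real CARD('n)"
      using norm_triangle_ineq4[of "mat 1" "mat 1 - \<psi> d"] by simp
    then show "norm d \<le> norm (mat 1 :: complex^'n^'n) + (real CARD('n))\<^sup>2 * real CARD('n)"
      by (simp add: norm_eq_sqrt_inner iso)
  qed
  ultimately show ?thesis by (simp add: compact_eq_bounded_closed)
qed

lemma convex_psd_slice: "convex psd_slice"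
  unfolding spectrahedron_eq_Inter[OF bilinear_matrix_vector[OF lin]]
  by (intro convex_INT convex_halfspace_le)

lemma zero_in_interior_psd_slice: "0 \<in> interior psd_slice"
proof -
  have "bounded_bilinear (\<lambda>d. (*v) (\<psi> d))"
    using bilinear_matrix_vector[OF lin] bilinear_conv_bounded_bilinear by blast
  then obtain K where K: "K > 0" "\<And>d x. norm (\<psi> d *v x) \<le> norm d * norm x * K"
    using bounded_bilinear.pos_bounded by blast
  have "ball 0 (1/K) \<subseteq> psd_slice"
  proof
    fix d :: 'a assume d: "d \<in> ball 0 (1/K)"
    show "d \<in> psd_slice" unfolding spectrahedron_def
    proof safe
      fix x
      have "x \<bullet> (\<psi> d *v x) \<le> norm x * norm (\<psi> d *v x)" by (rule norm_cauchy_schwarz)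
      also have "\<dots> \<le> norm x * (norm d * norm x * K)" by (intro mult_left_mono K) simp
      also have "\<dots> = (norm d * K) * (x \<bullet> x)" by (simp add: dot_square_norm power2_eq_square)
      also have "\<dots> \<le> 1 * (x \<bullet> x)"
        using d K(1) by (intro mult_right_mono) (auto simp: field_simps)
      finally show "x \<bullet> (\<psi> d *v x) \<le> x \<bullet> x" by simp
    qed
  qed
  then show ?thesis using K(1)
    by (meson centre_in_ball divide_pos_pos interior_maximal open_ball subsetD zero_less_one)
qed

text \<open>The pairing of \<open>\<psi> x + 1/n\<close> with \<open>t 1 + \<psi> z\<close> is \<open>t + x \<bullet> z\<close>. A positive semidefinite \<open>t 1 + \<psi> z\<close>
  has \<open>t \<ge> 0\<close>; for \<open>t > 0\<close> the point \<open>- z / t\<close> lies in the slice, and for \<open>t = 0\<close> the whole ray in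
  direction \<open>- z\<close> does. Both cases are covered by the points \<open>- r z\<close> with \<open>r \<ge> 0\<close> and \<open>r t \<le> 1\<close>.\<close>

lemma mem_polar_psd_slice_iff:
  "x \<in> polar psd_slice \<longleftrightarrow>
    (\<forall>p\<in>S. pos_semidef p \<longrightarrow> 0 \<le> (\<psi> x + (1 / real CARD('n)) *\<^sub>R mat 1) \<bullet> p)"
proof
  let ?s = "\<psi> x + (1 / real CARD('n)) *\<^sub>R mat 1"
  have val: "?s \<bullet> (t *\<^sub>R mat 1 + \<psi> z) = t + x \<bullet> z" for t z
    using identification_image(3)
    by (simp add: inner_add_left inner_add_right inner_mat_1_mat_1 iso inner_commute[of "\<psi> _" "mat 1"])
  {
    assume x: "\<forall>p\<in>S. pos_semidef p \<longrightarrow> 0 \<le> ?s \<bullet> p"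
    show "x \<in> polar psd_slice" unfolding polar_def
    proof safe
      fix d assume "d \<in> psd_slice"
      then have "0 \<le> ?s \<bullet> (mat 1 - \<psi> d)"
        using x by (simp add: mem_psd_slice_iff operator_system_closed identification_image)
      then show "x \<bullet> d \<le> 1" using val[of 1 "- d"] by (simp add: linear_neg[OF lin])
    qed
  }
  assume x: "x \<in> polar psd_slice"
  show "\<forall>p\<in>S. pos_semidef p \<longrightarrow> 0 \<le> ?s \<bullet> p"
  proof safe
    fix p assume p: "p \<in> S" "pos_semidef p"
    define t where "t = (mat 1 \<bullet> p) / real CARD('n)"
    obtain v where v: "v \<in> traceless_hermitian S" "p = t *\<^sub>R mat 1 + v"
      using decompose_hermitian[OF p(1)] p(2) by (auto simp: t_def pos_semidef_def)
    then obtain z where z: "p = t *\<^sub>R mat 1 + \<psi> z" using range by (metis imageE)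
    have "0 \<le> (real CARD('n))\<^sup>2 * (mat 1 \<bullet> p)"
      using norm_le_trace_if_pos_semidef[OF p(2)] norm_ge_zero[of p] by linarith
    then have t: "t \<ge> 0" by (simp add: t_def zero_le_mult_iff)
    have "- r * (x \<bullet> z) \<le> 1" if r: "r \<ge> 0" "r * t \<le> 1" for r
    proof -
      have "- (r *\<^sub>R z) \<in> psd_slice" unfolding mem_psd_slice_iff pos_semidef_iff
      proof safe
        show "hermitian (mat 1 - \<psi> (- (r *\<^sub>R z)))" by (intro hermitian_closed identification_image)
        fix y
        have "0 \<le> y \<bullet> (p *v y)" using p(2) by (simp add: pos_semidef_iff)
        then have "0 \<le> r * (y \<bullet> (p *v y)) + (1 - r * t) * (y \<bullet> y)"
          using r by (intro add_nonneg_nonneg mult_nonneg_nonneg) auto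
        also have "\<dots> = y \<bullet> ((mat 1 - \<psi> (- (r *\<^sub>R z))) *v y)"
          by (simp add: z linear_neg[OF lin] linear_scale[OF lin] matrix_vector_mult_add_rdistrib
              matrix_vector_mult_scaleR inner_add_right algebra_simps)
        finally show "0 \<le> y \<bullet> ((mat 1 - \<psi> (- (r *\<^sub>R z))) *v y)" .
      qed
      then show ?thesis using x by (force simp: polar_def)
    qed
    note r = this
    have "0 \<le> t + x \<bullet> z"
    proof (cases "t = 0")
      case True
      show ?thesis
      proof (rule ccontr)
        assume "\<not> 0 \<le> t + x \<bullet> z"
        then have "x \<bullet> z < 0" using True by simp
        \<comment> \<open>This \<open>r\<close> makes \<open>- r (x \<bullet> z)\<close> equal to \<open>2\<close>.\<close>
        then show False using r[of "- 2 / (x \<bullet> z)"] True by (simp add: divide_simps)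
      qed
    next
      case False
      then show ?thesis using r[of "1/t"] t by (simp add: field_simps)
    qed
    then show "0 \<le> ?s \<bullet> p" by (simp add: z val)
  qed
qed

lemma image_polar_psd_slice:
  "\<psi> ` polar psd_slice = (\<lambda>s. s - (1 / real CARD('n)) *\<^sub>R mat 1) ` state_space S"
proof (intro equalityI subsetI)
  let ?I = "(1 / real CARD('n)) *\<^sub>R (mat 1 :: complex^'n^'n)"
  fix v assume "v \<in> \<psi> ` polar psd_slice"
  then obtain x where x: "x \<in> polar psd_slice" "v = \<psi> x" by blast
  have h: "hermitian (\<psi> x + ?I)" by (intro hermitian_closed identification_image)
  then have "trace (\<psi> x + ?I) = 1"
    by (simp add: trace_hermitian inner_add_right identification_image inner_mat_1_mat_1)
  then have "\<psi> x + ?I \<in> state_space S"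
    using x(1) h by (simp add: state_space_iff mem_polar_psd_slice_iff operator_system_closed identification_image)
  then show "v \<in> (\<lambda>s. s - ?I) ` state_space S" using x(2) by force
next
  let ?I = "(1 / real CARD('n)) *\<^sub>R (mat 1 :: complex^'n^'n)"
  fix v assume "v \<in> (\<lambda>s. s - ?I) ` state_space S"
  then obtain s where s: "s \<in> state_space S" "v = s - ?I" by blast
  then have s': "s \<in> S" "hermitian s" "mat 1 \<bullet> s = 1"
    using trace_hermitian[of s] by (auto simp: state_space_iff)
  obtain w where "w \<in> traceless_hermitian S" "s = ?I + w"
    using decompose_hermitian[OF s'(1,2)] s'(3) by auto
  then obtain x where "s = \<psi> x + ?I" using range by (metis imageE add.commute)
  then show "v \<in> \<psi> ` polar psd_slice" using s by (auto simp: mem_polar_psd_slice_iff state_space_iff)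
qed

lemma polar_psd_slice_in_class_C'': "polar psd_slice \<in> class_C''"
proof (rule polar_in_class_C''[OF compact_psd_slice convex_psd_slice zero_in_interior_psd_slice])
  fix G assume "G face_of psd_slice"
  then show "G exposed_face_of psd_slice"
    using bilinear_matrix_vector[OF lin] identification_image(2)
    by (intro face_of_spectrahedron_exposed)
      (auto simp: inner_matrix_vector_adjoint hermitian_def linear_id[unfolded id_def])
qed

end

end

theorem corollary6p3:
  fixes S :: "(complex^'n^'n) set"
  assumes "operator_system S"
    and "cmat.dim S > 1"
    and "CARD('m) = cmat.dim S - 1"
  shows "(\<exists>\<psi> :: real^'m \<Rightarrow> complex^'n^'n. hs_identification (traceless_hermitian S) \<psi>) \<and>
    (\<forall>\<psi> :: real^'m \<Rightarrow> complex^'n^'n. hs_identification (traceless_hermitian S) \<psi> \<longrightarrow>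
      (\<exists>C \<in> class_C''. \<psi> ` C = (\<lambda>s. s - (1 / real CARD('n)) *\<^sub>R mat 1) ` state_space S))"
proof (intro conjI allI impI)
  show "\<exists>\<psi> :: real^'m \<Rightarrow> complex^'n^'n. hs_identification (traceless_hermitian S) \<psi>"
    using assms(3) by (rule ex_hs_identification[OF assms(1)])
next
  fix \<psi> :: "real^'m \<Rightarrow> complex^'n^'n"
  assume "hs_identification (traceless_hermitian S) \<psi>"
  then have lin: "linear \<psi>" and range: "range \<psi> = traceless_hermitian S"
    and hs: "\<And>x y. hs_inner (\<psi> x) (\<psi> y) = complex_of_real (x \<bullet> y)"
    by (auto simp: hs_identification_def)
  have iso: "\<psi> x \<bullet> \<psi> y = x \<bullet> y" for x y
    using hs[of x y] Re_hs_inner[of "\<psi> x" "\<psi> y"] by simp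
  show "\<exists>C\<in>class_C''. \<psi> ` C = (\<lambda>s. s - (1 / real CARD('n)) *\<^sub>R mat 1) ` state_space S"
    using polar_psd_slice_in_class_C''[OF assms(1) lin range iso] image_polar_psd_slice[OF assms(1) lin range iso]
    by blast
qed

end
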